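(* The measure $\nu\times\mathcal{L}^1$ on $(M\times I,d_p)$ is non pointwise doubling almost everywhere. Indeed, for almost every $(x,t)\in M\times I$, \[\limsup_{r\downarrow 0}\frac{\nu\times\mathcal{L}^1(B_p((x,t),4r))}{\nu\times\mathcal{L}^1(B_p((x,t),r))}=\infty.\]
   Context: Let $M:=\{(a_1,a_2,a_3,\ldots):a_i\in\{1,\ldots,i\}\}$ with the metric $d_M(a,b)=1/2^k$ where $k=\min\{i:a_i\neq b_i\}$ for $a\ne b$ (and $d_M(a,a)=0$). For $k\ge1$, an island of level $k$ is a set of all sequences in $M$ with prescribed first $k$ coordinates. Let $\nu$ be the Borel probability measure on $M$ giving every island of level $k$ the measure $\nu_k=1/k!$. Let $I=[0,1]$, let $\mathcal{L}^1$ be Lebesgue measure on $I$, and for integers $k\ge0$ let $I_k:=\{n/2^k:n\in\mathbb{Z},\ 0\le n\le 2^k\}$. Define the pseudometric $d_p$ on $M\times I$ by \[d_p((x,t),(y,s)):=\inf\{|t-u|+|u-s|: u\in I_k \text{ for some integer } k\ge 0 \text{ with } d_M(x,y)<1/2^k\}.\] $B_p((x,t),r)$ denotes the open ball with centre $(x,t)$ and radius $r>0$ in $(M\times I,d_p)$. $\nu\times\mathcal{L}^1$ is a Borel measure on $(M\times I,d_p)$. A Borel measure $\mu$ on a (pseudo)metric space is pointwise doubling at $x$ if $\limsup_{r\downarrow0}\mu(B(x,2r))/\mu(B(x,r))<\infty$; "non pointwise doubling almost everywhere" means that at almost every point it is not pointwise doubling. *)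

theory Defs
  imports "HOL-Probability.Probability"
begin

text \<open>
  Sequences are indexed from 1, so they are functions on \<open>{1..}\<close>, extended by
  \<open>undefined\<close> at index 0.  Two elements of \<open>seqM\<close> therefore always agree at 0, and the
  \<open>LEAST\<close> in \<open>dM\<close> ranges over the positive indices.
\<close>

definition seqM :: "(nat \<Rightarrow> nat) set" where
  "seqM = (\<Pi>\<^sub>E i\<in>{1..}. {1..i})"

definition dM :: "(nat \<Rightarrow> nat) \<Rightarrow> (nat \<Rightarrow> nat) \<Rightarrow> real" where
  "dM a b = (if a = b then 0 else 1 / 2 ^ (LEAST i. a i \<noteq> b i))"

text \<open>Every island of level \<open>k\<close> has the form \<open>island k a\<close> for some \<open>a \<in> seqM\<close>.\<close>

definition island :: "nat \<Rightarrow> (nat \<Rightarrow> nat) \<Rightarrow> (nat \<Rightarrow> nat) set" where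
  "island k a = {b \<in> seqM. \<forall>i\<in>{1..k}. b i = a i}"

lemma dM_less_iff:
  assumes "a \<in> seqM" "b \<in> seqM"
  shows "dM a b < 1 / 2 ^ k \<longleftrightarrow> (\<forall>i\<in>{1..k}. a i = b i)"
proof (cases "a = b")
  case False
  define m where "m = (LEAST i. a i \<noteq> b i)"
  have ne: "\<exists>i. a i \<noteq> b i" using False by auto
  have m: "a m \<noteq> b m" unfolding m_def using ne by (rule LeastI_ex)
  have lt: "a i = b i" if "i < m" for i using not_less_Least that unfolding m_def by blast
  have "a 0 = b 0" using assms by (auto simp: seqM_def PiE_def extensional_def)
  hence m1: "m \<ge> 1" using m by (cases m) auto
  have "dM a b < 1 / 2 ^ k \<longleftrightarrow> k < m"
    using False by (simp add: dM_def m_def[symmetric] field_simps)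
  also have "\<dots> \<longleftrightarrow> (\<forall>i\<in>{1..k}. a i = b i)"
    using m m1 lt by (meson atLeastAtMost_iff le_less_trans not_le_imp_less)
  finally show ?thesis .
qed (simp add: dM_def)

interpretation seqM: Metric_space seqM dM
proof
  show "0 \<le> dM a b" for a b by (simp add: dM_def)
  show "dM a b = dM b a" for a b unfolding dM_def by (simp add: eq_commute)
  show "dM a b = 0 \<longleftrightarrow> a = b" for a b by (simp add: dM_def)
  show "dM a c \<le> dM a b + dM b c" for a b c
  proof (cases "a = b \<or> b = c \<or> a = c")
    case True
    thus ?thesis by (auto simp: dM_def)
  next
    case False
    hence ne: "a \<noteq> b" "b \<noteq> c" "a \<noteq> c" by blast+
    define m where "m = (LEAST i. a i \<noteq> c i)"
    have "\<exists>i. a i \<noteq> c i" using ne(3) by blast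
    hence "a m \<noteq> c m" unfolding m_def by (rule LeastI_ex)
    hence "a m \<noteq> b m \<or> b m \<noteq> c m" by metis
    hence "(LEAST i. a i \<noteq> b i) \<le> m \<or> (LEAST i. b i \<noteq> c i) \<le> m"
      by (metis (mono_tags, lifting) Least_le)
    hence "1 / 2 ^ m \<le> dM a b \<or> 1 / 2 ^ m \<le> dM b c"
      using ne(1,2) by (simp add: dM_def divide_simps)
    moreover have "dM a c = 1 / 2 ^ m" using ne(3) by (simp add: dM_def m_def)
    moreover have "dM a b \<ge> 0" "dM b c \<ge> 0" by (simp_all add: dM_def)
    ultimately show ?thesis by linarith
  qed
qed

definition dyadic :: "nat \<Rightarrow> real set" where
  "dyadic k = {real_of_int n / 2 ^ k | n. 0 \<le> n \<and> n \<le> 2 ^ k}"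

definition dp :: "(nat \<Rightarrow> nat) \<times> real \<Rightarrow> (nat \<Rightarrow> nat) \<times> real \<Rightarrow> real" where
  "dp = (\<lambda>(x, t) (y, s).
     Inf {\<bar>t - u\<bar> + \<bar>u - s\<bar> | u. \<exists>k. dM x y < 1 / 2 ^ k \<and> u \<in> dyadic k})"

text \<open>Open ball of the pseudometric space \<open>(X, d)\<close>.\<close>

definition pball :: "'a set \<Rightarrow> ('a \<Rightarrow> 'a \<Rightarrow> real) \<Rightarrow> 'a \<Rightarrow> real \<Rightarrow> 'a set" where
  "pball X d x r = {y \<in> X. d x y < r}"

definition pointwise_doubling_at ::
    "'a set \<Rightarrow> ('a \<Rightarrow> 'a \<Rightarrow> real) \<Rightarrow> 'a measure \<Rightarrow> 'a \<Rightarrow> bool" where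
  "pointwise_doubling_at X d \<mu> x \<longleftrightarrow>
     Limsup (at_right 0)
       (\<lambda>r. emeasure \<mu> (pball X d x (2 * r)) / emeasure \<mu> (pball X d x r)) < \<infinity>"

definition island_measure :: "(nat \<Rightarrow> nat) measure \<Rightarrow> bool" where
  "island_measure \<nu> \<longleftrightarrow>
     prob_space \<nu> \<and>
     space \<nu> = seqM \<and>
     sets \<nu> = sigma_sets seqM {U. openin seqM.mtopology U} \<and>
     (\<forall>k\<ge>1. \<forall>a\<in>seqM. emeasure \<nu> (island k a) = ennreal (1 / fact k))"

lemma seqM_openin_iff:
  "openin seqM.mtopology U \<longleftrightarrow> U \<subseteq> seqM \<and> (\<forall>a\<in>U. \<exists>k. island k a \<subseteq> U)"
proof -
  have isl: "island k a = seqM.mball a (1 / 2 ^ k)" if "a \<in> seqM" for k a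
    using that by (auto simp: island_def dM_less_iff)
  have "(\<exists>r>0. seqM.mball a r \<subseteq> U) \<longleftrightarrow> (\<exists>k. island k a \<subseteq> U)" if "a \<in> seqM" for a
  proof
    assume "\<exists>r>0. seqM.mball a r \<subseteq> U"
    then obtain r where r: "r > 0" "seqM.mball a r \<subseteq> U" by blast
    obtain k where "(1/2::real) ^ k < r" using real_arch_pow_inv[of r "1/2"] r by auto
    hence "seqM.mball a (1 / 2 ^ k) \<subseteq> seqM.mball a r"
      by (intro seqM.mball_subset_concentric) (simp add: power_one_over)
    thus "\<exists>k. island k a \<subseteq> U" using r isl[OF that] by auto
  next
    assume "\<exists>k. island k a \<subseteq> U"
    then obtain k where "island k a \<subseteq> U" by blast
    hence "seqM.mball a (1 / 2 ^ k) \<subseteq> U" using isl[OF that] by simp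
    thus "\<exists>r>0. seqM.mball a r \<subseteq> U" by (intro exI[of _ "1 / 2 ^ k"]) auto
  qed
  thus ?thesis unfolding seqM.openin_mtopology by blast
qed

text \<open>The product of the uniform measures on the sets \<open>{1..i}\<close> is such a measure.\<close>

lemma island_measure_exists: "\<exists>\<nu>. island_measure \<nu>"
proof -
  define u where "u = (\<lambda>i. if i \<ge> 1 then uniform_count_measure {1..i::nat} else uniform_count_measure {0})"
  define \<nu> where "\<nu> = PiM {1..} u"
  have pu: "prob_space (u i)" for i
    unfolding u_def by (auto intro!: prob_space_uniform_count_measure)
  interpret product_prob_space u "{1..}"
    using pu by (simp add: product_prob_space_def product_prob_space_axioms_def
        product_sigma_finite_def prob_space_imp_sigma_finite)
  have spu: "space (u i) = {1..i}" "sets (u i) = Pow {1..i}" if "i \<ge> 1" for i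
    using that by (auto simp: u_def space_uniform_count_measure sets_uniform_count_measure)
  have sp: "space \<nu> = seqM"
    unfolding \<nu>_def space_PiM seqM_def by (intro PiE_cong) (auto simp: spu)
  have emb: "island k a = prod_emb {1..} u {1..k} (\<Pi>\<^sub>E i\<in>{1..k}. {a i})" if "a \<in> seqM" for k a
  proof -
    have s: "(\<Pi>\<^sub>E i\<in>{1..}. space (u i)) = seqM" using sp by (simp add: \<nu>_def space_PiM)
    show ?thesis unfolding prod_emb_def s
      by (auto simp: island_def restrict_def PiE_iff extensional_def)
  qed
  have ai: "a i \<in> {1..i}" if "a \<in> seqM" "i \<ge> 1" for a i
    using that by (auto simp: seqM_def PiE_iff)
  have island_sets: "island k a \<in> sets \<nu>" if "a \<in> seqM" for k a
    unfolding emb[OF that] \<nu>_def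
    using ai[OF that] by (intro sets_PiM_I) (auto simp: spu)
  have island_em: "emeasure \<nu> (island k a) = ennreal (1 / fact k)" if "a \<in> seqM" for k a
  proof -
    have "emeasure \<nu> (island k a) = (\<Prod>i\<in>{1..k}. emeasure (u i) {a i})"
      unfolding emb[OF that] \<nu>_def
      using ai[OF that] by (intro emeasure_PiM_emb) (auto simp: spu)
    also have "\<dots> = (\<Prod>i\<in>{1..k}. ennreal (1 / real i))"
    proof (rule prod.cong)
      fix i assume "i \<in> {1..k}"
      thus "emeasure (u i) {a i} = ennreal (1 / real i)"
        using ai[OF that, of i] by (simp add: u_def emeasure_uniform_count_measure)
    qed simp
    also have "\<dots> = ennreal (\<Prod>i\<in>{1..k}. 1 / real i)" by (intro prod_ennreal) auto
    also have "(\<Prod>i\<in>{1..k}. 1 / real i) = 1 / fact k"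
      by (simp add: fact_prod prod_dividef)
    finally show ?thesis .
  qed
  have fin: "finite ((\<lambda>a. island k a) ` seqM)" for k
  proof -
    have "(\<lambda>a. island k a) ` seqM \<subseteq> island k ` (\<Pi>\<^sub>E i\<in>{1..k}. {1..i})"
    proof
      fix S assume "S \<in> (\<lambda>a. island k a) ` seqM"
      then obtain a where a: "a \<in> seqM" "S = island k a" by blast
      have "S = island k (restrict a {1..k})" by (simp add: a(2) island_def)
      moreover have "restrict a {1..k} \<in> (\<Pi>\<^sub>E i\<in>{1..k}. {1..i})"
        unfolding restrict_PiE_iff using ai[OF a(1)] by simp
      ultimately show "S \<in> island k ` (\<Pi>\<^sub>E i\<in>{1..k}. {1..i})" by (rule image_eqI)
    qed
    moreover have "finite (island k ` (\<Pi>\<^sub>E i\<in>{1..k}. {1..i}))"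
      by (intro finite_imageI finite_PiE) auto
    ultimately show ?thesis by (rule finite_subset)
  qed
  have "sets \<nu> = sigma_sets seqM {U. openin seqM.mtopology U}"
  proof (rule antisym)
    have eq: "sets \<nu> = sigma_sets seqM {{f \<in> seqM. f i \<in> A} | i A. i \<in> {1..} \<and> A \<in> sets (u i)}"
      using sp by (simp add: \<nu>_def sets_PiM_single space_PiM)
    show "sets \<nu> \<subseteq> sigma_sets seqM {U. openin seqM.mtopology U}"
      unfolding eq
    proof (rule sigma_sets_mono, rule subsetI)
      fix S assume "S \<in> {{f \<in> seqM. f i \<in> A} | i A. i \<in> {1..} \<and> A \<in> sets (u i)}"
      then obtain i A where S: "S = {f \<in> seqM. f i \<in> A}" "i \<ge> 1" by auto
      have "openin seqM.mtopology S"
        unfolding seqM_openin_iff S(1) using S(2) by (auto intro!: exI[of _ i] simp: island_def)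
      thus "S \<in> sigma_sets seqM {U. openin seqM.mtopology U}"
        by (intro sigma_sets.Basic) simp
    qed
    show "sigma_sets seqM {U. openin seqM.mtopology U} \<subseteq> sets \<nu>"
    proof (rule sets.sigma_sets_subset[where M = \<nu>, unfolded sp], rule subsetI)
      fix U assume "U \<in> {U. openin seqM.mtopology U}"
      hence U: "openin seqM.mtopology U" by simp
      define C where "C = {S. S \<subseteq> U \<and> (\<exists>k. S \<in> (\<lambda>a. island k a) ` seqM)}"
      have "C \<subseteq> (\<Union>k. (\<lambda>a. island k a) ` seqM)" by (auto simp: C_def)
      moreover have "countable (\<Union>k. (\<lambda>a. island k a) ` seqM)"
        using fin by (intro countable_UN) (auto intro: countable_finite)
      ultimately have "countable C" by (rule countable_subset)
      moreover have "C \<subseteq> sets \<nu>" using island_sets by (auto simp: C_def)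
      ultimately have "\<Union>C \<in> sets \<nu>" by (rule sets.countable_Union)
      moreover have "\<Union>C = U"
      proof
        show "U \<subseteq> \<Union>C"
        proof
          fix a assume a: "a \<in> U"
          then obtain k where "island k a \<subseteq> U" "a \<in> seqM" using U seqM_openin_iff by blast
          moreover from this have "a \<in> island k a" by (simp add: island_def)
          ultimately show "a \<in> \<Union>C" by (auto simp: C_def)
        qed
      qed (auto simp: C_def)
      ultimately show "U \<in> sets \<nu>" by simp
    qed
  qed
  moreover have "prob_space \<nu>" unfolding \<nu>_def by (rule prob_space_axioms)
  ultimately have "island_measure \<nu>"
    using sp island_em by (auto simp: island_measure_def)
  thus ?thesis ..
qed

text \<open>Balls of \<open>dp\<close> are measurable, so \<open>emeasure\<close> has no junk value on them.\<close>

lemma dp_less_iff: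
  assumes "x \<in> seqM" "y \<in> seqM"
  shows "dp (x, t) (y, s) < r \<longleftrightarrow>
    (\<exists>k. y \<in> island k x \<and> (\<exists>u\<in>dyadic k. \<bar>t - u\<bar> + \<bar>u - s\<bar> < r))"
proof -
  let ?S = "{\<bar>t - u\<bar> + \<bar>u - s\<bar> | u. \<exists>k. dM x y < 1 / 2 ^ k \<and> u \<in> dyadic k}"
  have "dM x y < 1 / 2 ^ 0" unfolding dM_less_iff[OF assms] by simp
  moreover have "(0::real) \<in> dyadic 0" unfolding dyadic_def by (auto intro!: exI[of _ 0])
  ultimately have ne: "?S \<noteq> {}" by blast
  have "bdd_below ?S" by (rule bdd_belowI[of _ 0]) auto
  hence "Inf ?S < r \<longleftrightarrow> (\<exists>v\<in>?S. v < r)" by (rule cInf_less_iff[OF ne])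
  moreover have "y \<in> island k x \<longleftrightarrow> dM x y < 1 / 2 ^ k" for k
    unfolding dM_less_iff[OF assms] island_def mem_Collect_eq using assms(2) by metis
  ultimately show ?thesis unfolding dp_def prod.case by blast
qed

lemma pball_dp_measurable:
  assumes "island_measure \<nu>" "x \<in> seqM"
  shows "pball (seqM \<times> {0..1}) dp (x, t) r \<in> sets (\<nu> \<Otimes>\<^sub>M restrict_space lborel {0..1})"
proof -
  let ?J = "\<lambda>k. {0..1} \<inter> (\<Union>u\<in>dyadic k. {s::real. \<bar>t - u\<bar> + \<bar>u - s\<bar> < r})"
  have "pball (seqM \<times> {0..1}) dp (x, t) r = (\<Union>k. island k x \<times> ?J k)"
  proof (intro set_eqI)
    fix p
    have "p \<in> pball (seqM \<times> {0..1}) dp (x, t) r \<longleftrightarrow>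
      fst p \<in> seqM \<and> snd p \<in> {0..1} \<and> dp (x, t) (fst p, snd p) < r"
      by (simp add: pball_def mem_Times_iff)
    also have "\<dots> \<longleftrightarrow> fst p \<in> seqM \<and> snd p \<in> {0..1} \<and>
      (\<exists>k. fst p \<in> island k x \<and> (\<exists>u\<in>dyadic k. \<bar>t - u\<bar> + \<bar>u - snd p\<bar> < r))"
      using dp_less_iff[OF assms(2)] by blast
    also have "\<dots> \<longleftrightarrow> p \<in> (\<Union>k. island k x \<times> ?J k)"
      unfolding mem_Times_iff UN_iff Int_iff mem_Collect_eq island_def by blast
    finally show "p \<in> pball (seqM \<times> {0..1}) dp (x, t) r \<longleftrightarrow> p \<in> (\<Union>k. island k x \<times> ?J k)" .
  qed
  moreover have "island k x \<in> sets \<nu>" for k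
  proof -
    have "openin seqM.mtopology (island k x)"
      unfolding seqM_openin_iff by (auto intro!: exI[of _ k] simp: island_def)
    thus ?thesis using assms(1) unfolding island_measure_def by auto
  qed
  moreover have "?J k \<in> sets (restrict_space lborel {0..1})" for k
  proof -
    have "open (\<Union>u\<in>dyadic k. {s::real. \<bar>t - u\<bar> + \<bar>u - s\<bar> < r})"
      by (intro open_UN ballI open_Collect_less continuous_intros)
    thus ?thesis by (auto simp: sets_restrict_space)
  qed
  ultimately show ?thesis by auto
qed

end

theory Submission imports Defs
begin

text \<open>
  A path in the pseudometric \<open>dp\<close> can move from the fibre over \<open>x\<close> to the fibre over \<open>y\<close> only at
  a height \<open>u\<close> in \<open>dyadic k\<close>, where \<open>k\<close> is a level at which \<open>x\<close> and \<open>y\<close> still lie in a common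
  island.  Fix a point \<open>(x, t)\<close> whose height \<open>t\<close> is not dyadic, and let \<open>r\<^sub>k > 0\<close> be the distance
  from \<open>t\<close> to \<open>dyadic k\<close>.

  \<^item> The ball of radius \<open>r\<^sub>k\<close> cannot reach a height in \<open>dyadic k\<close>, so it stays over the island of
    level \<open>k + 1\<close> around \<open>x\<close> and within vertical distance \<open>r\<^sub>k\<close> of \<open>t\<close>.  Its measure is at most
    \<open>2 r\<^sub>k / (k + 1)!\<close>.
  \<^item> The ball of radius \<open>2 r\<^sub>k\<close> reaches a nearest point \<open>u\<close> of \<open>dyadic k\<close> and has the length \<open>r\<^sub>k\<close>
    left.  It contains the product of the island of level \<open>k\<close> with a one-sided interval
    of length \<open>r\<^sub>k\<close> at \<open>u\<close>, and its measure is at least \<open>r\<^sub>k / k!\<close>.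

  For \<open>k \<ge> 1\<close> the ratio is therefore at least \<open>(k + 1) / 2\<close>.  Since \<open>r\<^sub>k \<longlonglongrightarrow> 0\<close>, the upper limit is infinite for the
  factor 2, and by monotonicity for every larger factor, in particular 4.  This holds for all \<open>x\<close>
  and all \<open>t\<close> outside the countable set of dyadic numbers, hence almost everywhere.
\<close>

section \<open>Distance to the dyadic heights\<close>

lemma finite_dyadic: "finite (dyadic k)"
proof -
  have "dyadic k = (\<lambda>n. real_of_int n / 2 ^ k) ` {0..2 ^ k}"
    by (auto simp: dyadic_def)
  thus ?thesis by simp
qed

lemma dyadic_nonempty: "dyadic k \<noteq> {}"
  by (auto simp: dyadic_def intro!: exI[of _ 0])

lemma dyadic_unit_interval: "dyadic k \<subseteq> {0..1}"
proof
  fix u assume "u \<in> dyadic k"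
  then obtain n :: int where n: "u = real_of_int n / 2 ^ k" "0 \<le> n" "n \<le> 2 ^ k"
    by (auto simp: dyadic_def)
  have "real_of_int n \<le> 2 ^ k"
    using n(3) by (metis of_int_le_iff of_int_numeral of_int_power)
  hence "u \<le> 2 ^ k / 2 ^ k" unfolding n(1) by (intro divide_right_mono) auto
  moreover have "0 \<le> u" using n(1,2) by simp
  ultimately show "u \<in> {0..1}" by simp
qed

lemma dyadic_mono:
  assumes "j \<le> k"
  shows "dyadic j \<subseteq> dyadic k"
proof
  fix u assume "u \<in> dyadic j"
  then obtain n :: int where n: "u = real_of_int n / 2 ^ j" "0 \<le> n" "n \<le> 2 ^ j"
    by (auto simp: dyadic_def)
  have p: "(2::'a::comm_semiring_1) ^ k = 2 ^ j * 2 ^ (k - j)"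
    using assms by (simp flip: power_add)
  have "u = real_of_int (n * 2 ^ (k - j)) / 2 ^ k"
    by (simp add: n(1) p)
  moreover have "0 \<le> n * 2 ^ (k - j)" "n * 2 ^ (k - j) \<le> 2 ^ k"
    using n(2,3) by (auto simp: p intro: mult_right_mono)
  ultimately show "u \<in> dyadic k" unfolding dyadic_def by blast
qed

lemma infdist_dyadic_pos:
  assumes "t \<notin> dyadic k"
  shows "0 < infdist t (dyadic k)"
  using finite_imp_closed[OF finite_dyadic] dyadic_nonempty assms
  by (rule infdist_pos_not_in_closed)

lemma infdist_dyadic_le:
  assumes "t \<in> {0..1}"
  shows "infdist t (dyadic k) \<le> 1 / 2 ^ k"
proof -
  define n where "n = \<lfloor>t * 2 ^ k\<rfloor>"
  have "n \<le> \<lfloor>(2::real) ^ k\<rfloor>" unfolding n_def using assms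
    by (intro floor_mono) (simp add: mult_left_le_one_le)
  moreover have "\<lfloor>(2::real) ^ k\<rfloor> = 2 ^ k"
    by (metis floor_of_int of_int_numeral of_int_power)
  moreover have "0 \<le> n" unfolding n_def using assms by simp
  ultimately have "real_of_int n / 2 ^ k \<in> dyadic k" unfolding dyadic_def by auto
  hence "infdist t (dyadic k) \<le> \<bar>t - real_of_int n / 2 ^ k\<bar>"
    using infdist_le by (metis dist_real_def)
  also have "t - real_of_int n / 2 ^ k = (t * 2 ^ k - real_of_int n) / 2 ^ k"
    by (simp add: field_simps)
  also have "\<bar>\<dots>\<bar> \<le> 1 / 2 ^ k"
    unfolding n_def abs_divide by (intro divide_mono) (auto simp: abs_le_iff, linarith+)
  finally show ?thesis .
qed

lemma infdist_dyadic_tendsto: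
  assumes "t \<in> {0..1}" "\<And>k. t \<notin> dyadic k"
  shows "filterlim (\<lambda>k. infdist t (dyadic k)) (at_right 0) sequentially"
proof (rule tendsto_imp_filterlim_at_right)
  have "(\<lambda>k. (1 / 2) ^ k :: real) \<longlonglongrightarrow> 0" by (rule LIMSEQ_power_zero) simp
  hence lim: "(\<lambda>k. 1 / 2 ^ k :: real) \<longlonglongrightarrow> 0" by (simp add: power_one_over)
  show "(\<lambda>k. infdist t (dyadic k)) \<longlonglongrightarrow> 0"
    by (rule tendsto_sandwich[OF always_eventually always_eventually tendsto_const lim])
      (use infdist_dyadic_le[OF assms(1)] infdist_nonneg in blast)+
  show "eventually (\<lambda>k. infdist t (dyadic k) > 0) sequentially"
    using assms(2) by (simp add: infdist_dyadic_pos)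
qed

section \<open>Measures of balls at the critical radii\<close>

lemma island_mem_sets:
  assumes "island_measure \<nu>"
  shows "island k x \<in> sets \<nu>"
proof -
  have "openin seqM.mtopology (island k x)"
    unfolding seqM_openin_iff by (auto intro!: exI[of _ k] simp: island_def)
  thus ?thesis using assms unfolding island_measure_def by auto
qed

lemma emeasure_island_times:
  assumes "island_measure \<nu>" "x \<in> seqM" "k \<ge> 1" "A \<in> sets lborel" "A \<subseteq> {0..1::real}"
  shows "emeasure (\<nu> \<Otimes>\<^sub>M restrict_space lborel {0..1}) (island k x \<times> A)
    = ennreal (1 / fact k) * emeasure lborel A"
proof -
  interpret L: finite_measure "restrict_space lborel {0..1::real}"
    by (intro finite_measureI) (simp add: emeasure_restrict_space space_restrict_space)
  have "A \<in> sets (restrict_space lborel {0..1})"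
    using assms(4,5) by (auto simp: sets_restrict_space)
  hence "emeasure (\<nu> \<Otimes>\<^sub>M restrict_space lborel {0..1}) (island k x \<times> A)
    = emeasure \<nu> (island k x) * emeasure (restrict_space lborel {0..1}) A"
    using island_mem_sets[OF assms(1)] by (intro L.emeasure_pair_measure_Times) auto
  thus ?thesis
    using assms by (simp add: emeasure_restrict_space island_measure_def)
qed

text \<open>
  A detour from \<open>t\<close> through \<open>u\<close> to \<open>s\<close> of length less than \<open>r\<close> has \<open>\<bar>t - u\<bar> < r\<close>, so \<open>u\<close> is not
  in \<open>dyadic k\<close>, nor in the smaller sets \<open>dyadic j\<close> with \<open>j \<le> k\<close>; only deeper levels remain.  The
  vertical bound is the triangle inequality for the same detour.
\<close>

lemma pball_dp_subset_island:
  assumes "x \<in> seqM" "r \<le> infdist t (dyadic k)"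
  shows "pball (seqM \<times> {0..1}) dp (x, t) r
    \<subseteq> island (Suc k) x \<times> ({t - r..t + r} \<inter> {0..1})"
proof
  fix p assume "p \<in> pball (seqM \<times> {0..1}) dp (x, t) r"
  then obtain y s where p: "p = (y, s)" "y \<in> seqM" "s \<in> {0..1}" "dp (x, t) (y, s) < r"
    by (auto simp: pball_def)
  then obtain j u where j: "y \<in> island j x" "u \<in> dyadic j" "\<bar>t - u\<bar> + \<bar>u - s\<bar> < r"
    using dp_less_iff[OF assms(1) p(2)] by blast
  have "k < j"
  proof (rule ccontr)
    assume "\<not> k < j"
    hence "u \<in> dyadic k" using j(2) dyadic_mono[of j k] by auto
    hence "infdist t (dyadic k) \<le> \<bar>t - u\<bar>" using infdist_le by (metis dist_real_def)
    thus False using j(3) assms(2) by linarith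
  qed
  hence "y \<in> island (Suc k) x" using j(1) by (auto simp: island_def)
  moreover have "s \<in> {t - r..t + r}" using j(3) by (auto simp: abs_if split: if_splits)
  ultimately show "p \<in> island (Suc k) x \<times> ({t - r..t + r} \<inter> {0..1})"
    using p by simp
qed

lemma emeasure_pball_dp_upper:
  assumes "island_measure \<nu>" "x \<in> seqM" "0 \<le> r" "r \<le> infdist t (dyadic k)"
  shows "emeasure (\<nu> \<Otimes>\<^sub>M restrict_space lborel {0..1}) (pball (seqM \<times> {0..1}) dp (x, t) r)
    \<le> ennreal (2 * r / fact (Suc k))"
proof -
  let ?\<mu> = "\<nu> \<Otimes>\<^sub>M restrict_space lborel {0..1::real}"
  let ?A = "{t - r..t + r} \<inter> {0..1}"
  have sets: "island (Suc k) x \<times> ?A \<in> sets ?\<mu>"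
    using island_mem_sets[OF assms(1)] by (intro pair_measureI) (auto simp: sets_restrict_space)
  have "emeasure ?\<mu> (pball (seqM \<times> {0..1}) dp (x, t) r) \<le> emeasure ?\<mu> (island (Suc k) x \<times> ?A)"
    using pball_dp_subset_island[OF assms(2,4)] sets by (rule emeasure_mono)
  also have "\<dots> = ennreal (1 / fact (Suc k)) * emeasure lborel ?A"
    using assms by (intro emeasure_island_times) auto
  also have "emeasure lborel ?A \<le> emeasure lborel {t - r..t + r}"
    by (intro emeasure_mono) auto
  also have "\<dots> = ennreal (2 * r)" using assms(3) by simp
  also have "ennreal (1 / fact (Suc k)) * ennreal (2 * r) = ennreal (2 * r / fact (Suc k))"
    using assms(3) by (simp flip: ennreal_mult)
  finally show ?thesis by (simp add: mult_left_mono)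
qed

text \<open>
  A one-sided interval at a nearest point of \<open>dyadic k\<close> is used because that point may be 0 or 1;
  the direction is chosen so that the interval stays inside the unit interval.
\<close>

lemma emeasure_pball_dp_lower:
  assumes "island_measure \<nu>" "x \<in> seqM" "k \<ge> 1" "t \<in> {0..1}"
    and r: "r = infdist t (dyadic k)" and "c \<ge> 2"
  shows "ennreal (r / fact k) \<le>
    emeasure (\<nu> \<Otimes>\<^sub>M restrict_space lborel {0..1}) (pball (seqM \<times> {0..1}) dp (x, t) (c * r))"
proof -
  let ?\<mu> = "\<nu> \<Otimes>\<^sub>M restrict_space lborel {0..1::real}"
  have "(2::real) ^ 1 \<le> 2 ^ k" using assms(3) by (intro power_increasing) auto
  hence "1 / 2 ^ k \<le> (1 / 2 :: real)" by (simp add: field_simps)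
  hence half: "r \<le> 1 / 2" using infdist_dyadic_le[OF assms(4), of k] r by linarith
  have nonneg: "0 \<le> r" by (simp add: r infdist_nonneg)
  obtain u where u: "u \<in> dyadic k" "r = \<bar>t - u\<bar>"
    using infdist_attains_inf[OF finite_imp_closed[OF finite_dyadic] dyadic_nonempty]
    by (metis dist_real_def r)
  have u01: "u \<in> {0..1}" using u(1) dyadic_unit_interval by blast
  define a where "a = (if u \<le> 1 / 2 then u else u - r)"
  have a: "{a<..<a + r} \<subseteq> {0..1}" "{a<..<a + r} \<subseteq> {u - r<..<u + r}"
    using u01 half nonneg by (auto simp: a_def)
  have sub: "island k x \<times> {a<..<a + r} \<subseteq> pball (seqM \<times> {0..1}) dp (x, t) (c * r)"
  proof
    fix p assume "p \<in> island k x \<times> {a<..<a + r}"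
    then obtain y s where p: "p = (y, s)" "y \<in> island k x" "s \<in> {a<..<a + r}" by auto
    have y: "y \<in> seqM" using p(2) by (simp add: island_def)
    have "\<bar>u - s\<bar> < r" using p(3) a(2) by (auto simp: abs_if)
    moreover have "2 * r \<le> c * r" using assms(6) nonneg by (rule mult_right_mono)
    ultimately have "\<bar>t - u\<bar> + \<bar>u - s\<bar> < c * r" using u(2) by linarith
    hence "dp (x, t) (y, s) < c * r" using dp_less_iff[OF assms(2) y] p(2) u(1) by blast
    thus "p \<in> pball (seqM \<times> {0..1}) dp (x, t) (c * r)"
      using p(1,3) y a(1) by (auto simp: pball_def)
  qed
  have "ennreal (r / fact k) = ennreal (1 / fact k) * ennreal r"
    using nonneg by (simp flip: ennreal_mult)
  also have "ennreal r = emeasure lborel {a<..<a + r}" using nonneg by simp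
  also have "ennreal (1 / fact k) * \<dots> = emeasure ?\<mu> (island k x \<times> {a<..<a + r})"
    using assms a(1) by (intro emeasure_island_times[symmetric]) auto
  also have "\<dots> \<le> emeasure ?\<mu> (pball (seqM \<times> {0..1}) dp (x, t) (c * r))"
    using sub pball_dp_measurable[OF assms(1,2)] by (rule emeasure_mono)
  finally show ?thesis .
qed

section \<open>Failure of doubling\<close>

lemma ennreal_inverse_antimono: "(a::ennreal) \<le> b \<Longrightarrow> inverse b \<le> inverse a"
  including ennreal.lifting
  by transfer (auto intro: ereal_inverse_antimono)

lemma pball_dp_ratio_lower:
  assumes "island_measure \<nu>" "x \<in> seqM" "k \<ge> 1" "t \<in> {0..1}" "t \<notin> dyadic k"
    and r: "r = infdist t (dyadic k)" and "c \<ge> 2"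
    and \<mu>: "\<mu> = \<nu> \<Otimes>\<^sub>M restrict_space lborel {0..1::real}"
  shows "ennreal (real (Suc k) / 2) \<le>
    emeasure \<mu> (pball (seqM \<times> {0..1}) dp (x, t) (c * r))
      / emeasure \<mu> (pball (seqM \<times> {0..1}) dp (x, t) r)"
proof -
  have pos: "0 < r" unfolding r using assms(5) by (rule infdist_dyadic_pos)
  have "real (Suc k) / 2 = (r / fact k) / (2 * r / fact (Suc k))"
    using pos by (simp add: field_simps)
  hence "ennreal (real (Suc k) / 2) = ennreal (r / fact k) / ennreal (2 * r / fact (Suc k))"
    using pos by (simp add: divide_ennreal del: fact_Suc)
  also have "\<dots> \<le> emeasure \<mu> (pball (seqM \<times> {0..1}) dp (x, t) (c * r))
      / emeasure \<mu> (pball (seqM \<times> {0..1}) dp (x, t) r)"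
    unfolding divide_ennreal_def
  proof (intro mult_mono ennreal_inverse_antimono)
    show "ennreal (r / fact k) \<le> emeasure \<mu> (pball (seqM \<times> {0..1}) dp (x, t) (c * r))"
      unfolding \<mu> by (rule emeasure_pball_dp_lower[OF assms(1-4) r \<open>c \<ge> 2\<close>])
    show "emeasure \<mu> (pball (seqM \<times> {0..1}) dp (x, t) r) \<le> ennreal (2 * r / fact (Suc k))"
      unfolding \<mu>
      by (rule emeasure_pball_dp_upper[OF assms(1,2) less_imp_le[OF pos] eq_refl[OF r]])
  qed (rule zero_le)+
  finally show ?thesis .
qed

lemma Limsup_pball_dp_ratio:
  assumes "island_measure \<nu>" "x \<in> seqM" "t \<in> {0..1}" "\<And>k. t \<notin> dyadic k" "c \<ge> 2"
    and \<mu>: "\<mu> = \<nu> \<Otimes>\<^sub>M restrict_space lborel {0..1::real}"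
  shows "Limsup (at_right 0)
    (\<lambda>r. emeasure \<mu> (pball (seqM \<times> {0..1}) dp (x, t) (c * r))
      / emeasure \<mu> (pball (seqM \<times> {0..1}) dp (x, t) r)) = \<infinity>"
    (is "Limsup _ ?f = _")
proof (rule ccontr)
  assume "Limsup (at_right 0) ?f \<noteq> \<infinity>"
  hence "Limsup (at_right 0) ?f < top" by (simp add: top.not_eq_extremum)
  then obtain n where "Limsup (at_right 0) ?f < of_nat n"
    using ennreal_Ex_less_of_nat by blast
  hence "eventually (\<lambda>r. ?f r < of_nat n) (at_right 0)" by (rule Limsup_lessD)
  hence "eventually (\<lambda>k. ?f (infdist t (dyadic k)) < of_nat n) sequentially"
    using infdist_dyadic_tendsto[OF assms(3,4)] by (rule eventually_compose_filterlim)
  then obtain N where N: "?f (infdist t (dyadic k)) < of_nat n" if "k \<ge> N" for k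
    by (auto simp: eventually_sequentially)
  define k where "k = Max {N, 2 * n, 1}"
  have k: "N \<le> k" "2 * n \<le> k" "1 \<le> k" by (auto simp: k_def)
  have "real (2 * n) \<le> real (Suc k)" using k(2) by (simp only: of_nat_le_iff)
  hence "of_nat n \<le> ennreal (real (Suc k) / 2)"
    unfolding ennreal_of_nat_eq_real_of_nat by (intro ennreal_leI) simp
  also have "\<dots> \<le> ?f (infdist t (dyadic k))"
    by (rule pball_dp_ratio_lower[OF assms(1,2) k(3) assms(3,4) refl assms(5) \<mu>])
  finally show False using N[OF k(1)] by simp
qed

lemma AE_not_dyadic:
  assumes "island_measure \<nu>" and \<mu>: "\<mu> = \<nu> \<Otimes>\<^sub>M restrict_space lborel {0..1::real}"
  shows "AE p in \<mu>. fst p \<in> seqM \<and> snd p \<in> {0..1} \<and> (\<forall>k. snd p \<notin> dyadic k)"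
proof -
  define D where "D = (\<Union>k. dyadic k)"
  interpret L: finite_measure "restrict_space lborel {0..1::real}"
    by (intro finite_measureI) (simp add: emeasure_restrict_space space_restrict_space)
  have D: "countable D" "D \<subseteq> {0..1}"
    unfolding D_def
    by (intro countable_UN countableI_type countable_finite finite_dyadic)
      (intro UN_least dyadic_unit_interval)
  have sp: "space \<nu> = seqM" using assms(1) by (simp add: island_measure_def)
  have sets: "D \<in> sets (restrict_space lborel {0..1})"
    using D countable_imp_null_set_lborel[OF D(1)]
    by (simp add: sets_restrict_space_iff null_sets_def)
  have "emeasure \<mu> (seqM \<times> D) = emeasure \<nu> seqM * emeasure (restrict_space lborel {0..1}) D"
    unfolding \<mu> using sets sp by (intro L.emeasure_pair_measure_Times) (auto simp flip: sp)
  also have "emeasure (restrict_space lborel {0..1}) D = 0"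
    using D by (simp add: emeasure_restrict_space emeasure_lborel_countable)
  finally have "emeasure \<mu> (seqM \<times> D) = 0" by simp
  moreover have "seqM \<times> D \<in> sets \<mu>"
    unfolding \<mu> using sets by (intro pair_measureI) (auto simp flip: sp)
  moreover have "space \<mu> = seqM \<times> {0..1}"
    by (simp add: \<mu> space_pair_measure sp space_restrict_space)
  ultimately show ?thesis
    by (intro AE_I[of _ _ "seqM \<times> D"]) (auto simp: D_def)
qed

theorem theorem4p1:
  fixes \<nu> :: "(nat \<Rightarrow> nat) measure"
    and \<mu> :: "((nat \<Rightarrow> nat) \<times> real) measure"
  assumes "island_measure \<nu>"
    and "\<mu> = \<nu> \<Otimes>\<^sub>M restrict_space lborel {0..1::real}"
  shows "(AE p in \<mu>. \<not> pointwise_doubling_at (seqM \<times> {0..1}) dp \<mu> p) \<and>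
    (AE p in \<mu>. Limsup (at_right 0)
       (\<lambda>r. emeasure \<mu> (pball (seqM \<times> {0..1}) dp p (4 * r))
          / emeasure \<mu> (pball (seqM \<times> {0..1}) dp p r)) = \<infinity>)"
proof -
  have "AE p in \<mu>. Limsup (at_right 0)
      (\<lambda>r. emeasure \<mu> (pball (seqM \<times> {0..1}) dp p (c * r))
        / emeasure \<mu> (pball (seqM \<times> {0..1}) dp p r)) = \<infinity>" if "c \<ge> 2" for c
    using AE_not_dyadic[OF assms]
  proof (rule AE_mp, intro AE_I2 impI)
    fix p :: "(nat \<Rightarrow> nat) \<times> real"
    assume "fst p \<in> seqM \<and> snd p \<in> {0..1} \<and> (\<forall>k. snd p \<notin> dyadic k)"
    thus "Limsup (at_right 0)
      (\<lambda>r. emeasure \<mu> (pball (seqM \<times> {0..1}) dp p (c * r))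
        / emeasure \<mu> (pball (seqM \<times> {0..1}) dp p r)) = \<infinity>"
      using Limsup_pball_dp_ratio[OF assms(1) _ _ _ that assms(2), of "fst p" "snd p"] by simp
  qed
  from this[of 2] this[of 4] show ?thesis
    unfolding pointwise_doubling_at_def by (simp add: less_top[symmetric])
qed

end
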